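(* Let $Q\subset\mathcal{COP}^p$ be a nonempty closed convex set, and suppose that the set $T_0(Q)$ of all zeros of $Q$ is not empty. Let $\{\tau(j), j\in J_Q\}$ be the set of vertices of $\mathrm{conv}\,T_0(Q)$ and $M_Q(j)=\{k\in P: e_k^\top D\tau(j)=0\ \forall D\in Q\}$, $j\in J_Q$. Then there exists a matrix $\bar D\in Q$ such that $$t^\top\bar Dt>0\ \ \forall t\in T\setminus T_0(Q);\qquad t^\top\bar Dt=0\ \ \forall t\in T_0(Q);$$ $$e_k^\top\bar D\tau(j)>0\ \ \forall k\in P\setminus M_Q(j),\ \forall j\in J_Q.$$
   Context: Let $p>1$ be an integer, $P=\{1,\dots,p\}$, $e_1,\dots,e_p$ the standard basis of $\mathbb R^p$, $\mathcal S(p)$ the space of real symmetric $p\times p$ matrices, $\mathcal{COP}^p=\{D\in\mathcal S(p): t^\top Dt\ge 0\ \forall t\in\mathbb R^p_+\}$ the cone of copositive matrices, and $T=\{t\in\mathbb R^p_+: \sum_{k\in P}t_k=1\}$. For $Q\subset\mathcal{COP}^p$, the set of zeros of $Q$ is $T_0(Q)=\{t\in T: t^\top Dt=0\ \forall D\in Q\}$; for closed convex $Q$ with $T_0(Q)\neq\emptyset$, $\mathrm{conv}\,T_0(Q)$ is a polytope, so its set of vertices (extreme points) is finite. $\mathrm{conv}$ denotes convex hull. *)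

theory Defs
  imports "HOL-Analysis.Analysis"
begin

text \<open>
  The index set \<open>P = {1, ..., p}\<close> is the finite type \<open>'p\<close>, with \<open>p = CARD('p)\<close>;
  a product \<open>s\<^sup>T D t\<close> is written \<open>s \<bullet> (D *v t)\<close>, and \<open>e\<^sub>k\<close> is \<open>axis k 1\<close>.
\<close>

definition nonneg_orthant :: "(real ^ 'p) set"
  where "nonneg_orthant = {t. \<forall>k. 0 \<le> t $ k}"

definition copositive_cone :: "(real ^ 'p ^ 'p) set"
  where "copositive_cone =
    {D. transpose D = D \<and> (\<forall>t\<in>nonneg_orthant. 0 \<le> t \<bullet> (D *v t))}"

definition std_simplex :: "(real ^ 'p) set"
  where "std_simplex = {t \<in> nonneg_orthant. (\<Sum>k\<in>UNIV. t $ k) = 1}"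

definition zeros :: "(real ^ 'p ^ 'p) set \<Rightarrow> (real ^ 'p) set"
  where "zeros Q = {t \<in> std_simplex. \<forall>D\<in>Q. t \<bullet> (D *v t) = 0}"

definition zero_indices :: "(real ^ 'p ^ 'p) set \<Rightarrow> real ^ 'p \<Rightarrow> 'p set"
  where "zero_indices Q v = {k. \<forall>D\<in>Q. axis k 1 \<bullet> (D *v v) = 0}"

end

theory Submission
  imports Defs
begin

text \<open>
  The matrix is any point of the relative interior of \<open>Q\<close>: a linear functional that is
  nonnegative on \<open>Q\<close> and vanishes at a relative interior point vanishes on all of \<open>Q\<close>.
  This applies to \<open>D \<mapsto> t\<^sup>T D t\<close> for every \<open>t \<in> T\<close>, and to \<open>D \<mapsto> e\<^sub>k\<^sup>T D t\<close> for every
  zero \<open>t\<close> of \<open>Q\<close>, since a copositive form cannot decrease from a zero \<open>t\<close> in direction \<open>e\<^sub>k\<close>.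
\<close>

text \<open>The segment from \<open>x\<close> to \<open>z\<close> can be prolonged a little beyond
  \<open>z\<close> inside \<open>Q\<close>. There \<open>f\<close> takes the value
  \<open>(1 - e) * f x\<close> with \<open>e > 1\<close>, so a positive \<open>f x\<close> would
  make it negative.\<close>

lemma linear_nonneg_eq_0_on_rel_interior:
  fixes f :: "'a :: euclidean_space \<Rightarrow> real"
  assumes "linear f" "convex Q" "\<And>x. x \<in> Q \<Longrightarrow> 0 \<le> f x"
    and z: "z \<in> rel_interior Q" "f z = 0" and "x \<in> Q"
  shows "f x = 0"
proof -
  have "Q \<noteq> {}"
    using \<open>x \<in> Q\<close> by blast
  then obtain e where e: "e > 1" "(1 - e) *\<^sub>R x + e *\<^sub>R z \<in> Q"
    using convex_rel_interior_iff[OF \<open>convex Q\<close>, of z] z(1) \<open>x \<in> Q\<close> by blast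
  have "0 \<le> f ((1 - e) *\<^sub>R x + e *\<^sub>R z)"
    using assms(3) e(2) by blast
  also have "\<dots> = (1 - e) * f x"
    using z(2) by (simp add: linear_add[OF \<open>linear f\<close>] linear_cmul[OF \<open>linear f\<close>])
  finally have "f x \<le> 0"
    using e(1) by (simp add: zero_le_mult_iff)
  with assms(3)[OF \<open>x \<in> Q\<close>] show ?thesis
    by simp
qed

lemma linear_inner_matrix_vector_mult:
  "linear (\<lambda>D :: real ^ 'n ^ 'm. s \<bullet> (D *v t))"
  by (rule linearI)
    (simp_all add: matrix_vector_mult_add_rdistrib inner_add_right flip: scaleR_matrix_vector_assoc)

text \<open>On the ray \<open>t + s *\<^sub>R u\<close> the form has no constant term, so for small
  \<open>s > 0\<close> its sign is that of the linear coefficient, unless this vanishes.\<close>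

lemma copositive_cone_nonneg_at_zero:
  fixes D :: "real ^ 'p ^ 'p"
  assumes D: "D \<in> copositive_cone" and t: "t \<in> nonneg_orthant" "t \<bullet> (D *v t) = 0"
    and u: "u \<in> nonneg_orthant"
  shows "0 \<le> u \<bullet> (D *v t)"
proof (rule ccontr)
  define a b where "a = u \<bullet> (D *v t)" and "b = u \<bullet> (D *v u)"
  assume "\<not> 0 \<le> u \<bullet> (D *v t)"
  then have a: "a < 0"
    by (simp add: a_def)
  have b: "b \<ge> 0"
    using D u by (simp add: copositive_cone_def b_def)
  \<comment> \<open>Symmetry of \<open>D\<close> makes the two cross terms equal, giving the linear
    coefficient \<open>2 * a\<close>.\<close>
  have sym: "t \<bullet> (D *v u) = a"
    using D dot_lmul_matrix[of t D u] transpose_matrix_vector[of D t]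
    by (simp add: copositive_cone_def a_def inner_commute)
  \<comment> \<open>Chosen so that \<open>s * b\<close> is at most \<open>- a\<close>, whence
    \<open>2 * a + s * b\<close> is at most \<open>a < 0\<close>; the summand 1 keeps the
    denominator positive when \<open>b = 0\<close>.\<close>
  define s where "s = - a / (b + 1)"
  have s: "s > 0"
    using a b by (simp add: s_def divide_neg_pos)
  have "t + s *\<^sub>R u \<in> nonneg_orthant"
    using t(1) u s by (simp add: nonneg_orthant_def)
  then have "0 \<le> (t + s *\<^sub>R u) \<bullet> (D *v (t + s *\<^sub>R u))"
    using D by (simp add: copositive_cone_def)
  also have "\<dots> = s * (2 * a + s * b)"
    using t(2) sym
    by (simp add: matrix_vector_right_distrib matrix_vector_mult_scaleR inner_add_left
        inner_add_right a_def b_def algebra_simps)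
  finally have "0 \<le> 2 * a + s * b"
    using s by (simp add: zero_le_mult_iff)
  moreover have "s * b \<le> s * (b + 1)"
    using s by simp
  moreover have "s * (b + 1) = - a"
    using b by (simp add: s_def)
  ultimately show False
    using a by linarith
qed

theorem theorem2:
  fixes Q :: "(real ^ 'p ^ 'p) set"
    and \<tau> :: "'j \<Rightarrow> real ^ 'p"
    and J :: "'j set"
    and M :: "'j \<Rightarrow> 'p set"
  assumes "CARD('p) > 1"
    and "Q \<subseteq> copositive_cone"
    and "Q \<noteq> {}"
    and "closed Q"
    and "convex Q"
    and "zeros Q \<noteq> {}"
    and "bij_betw \<tau> J {v. v extreme_point_of (convex hull (zeros Q))}"
    and "\<And>j. j \<in> J \<Longrightarrow> M j = zero_indices Q (\<tau> j)"
  shows "\<exists>D\<in>Q.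
    (\<forall>t\<in>std_simplex - zeros Q. t \<bullet> (D *v t) > 0) \<and>
    (\<forall>t\<in>zeros Q. t \<bullet> (D *v t) = 0) \<and>
    (\<forall>j\<in>J. \<forall>k\<in>UNIV - M j. axis k 1 \<bullet> (D *v \<tau> j) > 0)"
proof -
  obtain D where D: "D \<in> rel_interior Q"
    using rel_interior_eq_empty[OF \<open>convex Q\<close>] \<open>Q \<noteq> {}\<close> by blast
  then have "D \<in> Q"
    using rel_interior_subset by blast
  \<comment> \<open>The contrapositive of the first lemma, for functionals of the matrix with
    \<open>s\<close> and \<open>t\<close> fixed. One \<open>D\<close> thus serves all pairs
    \<open>s\<close>, \<open>t\<close> at once.\<close>
  have pos: "0 < s \<bullet> (D *v t)"
    if "\<And>E. E \<in> Q \<Longrightarrow> 0 \<le> s \<bullet> (E *v t)" "\<exists>E\<in>Q. s \<bullet> (E *v t) \<noteq> 0" for s t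
    using linear_nonneg_eq_0_on_rel_interior[OF linear_inner_matrix_vector_mult \<open>convex Q\<close>
        that(1) D] that \<open>D \<in> Q\<close> by (metis order_le_less)
  have "0 < t \<bullet> (D *v t)" if "t \<in> std_simplex - zeros Q" for t
  proof (rule pos)
    show "0 \<le> t \<bullet> (E *v t)" if "E \<in> Q" for E
      using \<open>t \<in> _\<close> that assms(2) by (auto simp: std_simplex_def copositive_cone_def)
    show "\<exists>E\<in>Q. t \<bullet> (E *v t) \<noteq> 0"
      using \<open>t \<in> _\<close> by (auto simp: zeros_def)
  qed
  moreover have "t \<bullet> (D *v t) = 0" if "t \<in> zeros Q" for t
    using that \<open>D \<in> Q\<close> by (auto simp: zeros_def)
  moreover have "0 < axis k 1 \<bullet> (D *v \<tau> j)" if "j \<in> J" "k \<in> UNIV - M j" for j k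
  proof (rule pos)
    \<comment> \<open>A point of the hull need not be a zero of \<open>Q\<close>, but an extreme
      point of a hull lies in the generating set.\<close>
    have "\<tau> j extreme_point_of (convex hull (zeros Q))"
      using bij_betwE[OF assms(7)] \<open>j \<in> J\<close> by blast
    then have zero: "\<tau> j \<in> zeros Q"
      by (rule extreme_point_of_convex_hull)
    show "0 \<le> axis k 1 \<bullet> (E *v \<tau> j)" if "E \<in> Q" for E
    proof (rule copositive_cone_nonneg_at_zero)
      show "E \<in> copositive_cone"
        using that assms(2) by blast
      show "\<tau> j \<in> nonneg_orthant" "\<tau> j \<bullet> (E *v \<tau> j) = 0"
        using zero that by (auto simp: zeros_def std_simplex_def)
      show "axis k 1 \<in> nonneg_orthant"
        by (simp add: nonneg_orthant_def axis_def)
    qed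
    show "\<exists>E\<in>Q. axis k 1 \<bullet> (E *v \<tau> j) \<noteq> 0"
      using that assms(8)[OF \<open>j \<in> J\<close>] by (auto simp: zero_indices_def)
  qed
  ultimately show ?thesis
    using \<open>D \<in> Q\<close> by blast
qed

end
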